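(* Let $\Gamma=HNN(\Lambda,H,K,\phi)$ be an HNN extension, where $H,K$ are subgroups of $\Lambda$ and $\phi:H\to K$ is an isomorphism, with stable letter $t$, and let $\Gamma_0=\langle t\rangle$. Suppose that for each $\lambda\in\Lambda\setminus\{1\}$ there exists $j>0$ such that $\lambda\notin\operatorname{Dom}(\phi^j)$. Then $\Gamma_0$ is a malnormal subgroup of $\Gamma$.
   Context: The HNN extension $HNN(\Lambda,H,K,\phi)$ is the group generated by $\Lambda$ and the stable letter $t$ subject to the relations of $\Lambda$ and $t^{-1}ht=\phi(h)$ for all $h\in H$. For positive integers $j$, $\operatorname{Dom}(\phi^j)$ is defined by $\operatorname{Dom}(\phi)=H$ and, inductively, $\operatorname{Dom}(\phi^j)=\phi^{-1}(\operatorname{Dom}(\phi^{j-1})\cap K)\subset H$ for $j\ge 2$. A subgroup $\Gamma_0$ of $\Gamma$ is malnormal if $g\Gamma_0g^{-1}\cap\Gamma_0=\{1\}$ for every $g\in\Gamma\setminus\Gamma_0$. *)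

theory Defs
  imports "HOL-Algebra.Coset" "HOL-Algebra.Generated_Groups"
begin

text \<open>A letter \<open>(x, True)\<close> stands for the generator \<open>x\<close> and \<open>(x, False)\<close> for its formal
  inverse.\<close>

type_synonym 'g word = "('g \<times> bool) list"

inductive pres_eq :: "'g set \<Rightarrow> ('g word \<times> 'g word) set \<Rightarrow> 'g word \<Rightarrow> 'g word \<Rightarrow> bool"
  for X :: "'g set" and R :: "('g word \<times> 'g word) set"
where
  rel: "(u, v) \<in> R \<Longrightarrow> u \<in> lists (X \<times> UNIV) \<Longrightarrow> v \<in> lists (X \<times> UNIV) \<Longrightarrow> pres_eq X R u v"
| cancel: "x \<in> X \<Longrightarrow> pres_eq X R [(x, b), (x, \<not> b)] []"
| refl: "u \<in> lists (X \<times> UNIV) \<Longrightarrow> pres_eq X R u u"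
| sym: "pres_eq X R u v \<Longrightarrow> pres_eq X R v u"
| trans: "pres_eq X R u v \<Longrightarrow> pres_eq X R v w \<Longrightarrow> pres_eq X R u w"
| cong: "pres_eq X R u u' \<Longrightarrow> pres_eq X R v v' \<Longrightarrow> pres_eq X R (u @ v) (u' @ v')"

definition pres_class :: "'g set \<Rightarrow> ('g word \<times> 'g word) set \<Rightarrow> 'g word \<Rightarrow> 'g word set" where
  "pres_class X R u = {v. pres_eq X R u v}"

text \<open>The group with generators \<open>X\<close> and defining relations \<open>u = v\<close> for \<open>(u, v) \<in> R\<close>.\<close>

definition presented_group ::
  "'g set \<Rightarrow> ('g word \<times> 'g word) set \<Rightarrow> 'g word set monoid" where
  "presented_group X R =
    \<lparr>carrier = pres_class X R ` lists (X \<times> UNIV),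
     mult = (\<lambda>A B. {w. \<exists>u\<in>A. \<exists>v\<in>B. pres_eq X R (u @ v) w}),
     one = pres_class X R []\<rparr>"

lemma pres_eq_words:
  assumes "pres_eq X R u v"
  shows "u \<in> lists (X \<times> UNIV) \<and> v \<in> lists (X \<times> UNIV)"
  using assms by induction auto

lemma pres_class_eq_iff:
  assumes "u \<in> lists (X \<times> UNIV)"
  shows "pres_class X R u = pres_class X R v \<longleftrightarrow> pres_eq X R u v"
proof
  assume "pres_class X R u = pres_class X R v"
  then show "pres_eq X R u v"
    using pres_eq.refl[OF assms, of R] pres_eq.sym unfolding pres_class_def by blast
next
  assume "pres_eq X R u v"
  then show "pres_class X R u = pres_class X R v"
    using pres_eq.sym pres_eq.trans unfolding pres_class_def by blast
qed

lemma presented_group_simps: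
  "carrier (presented_group X R) = pres_class X R ` lists (X \<times> UNIV)"
  "\<one>\<^bsub>presented_group X R\<^esub> = pres_class X R []"
  by (simp_all add: presented_group_def)

lemma presented_group_mult:
  assumes "u \<in> lists (X \<times> UNIV)" "v \<in> lists (X \<times> UNIV)"
  shows "pres_class X R u \<otimes>\<^bsub>presented_group X R\<^esub> pres_class X R v = pres_class X R (u @ v)"
proof -
  have "pres_eq X R u u" "pres_eq X R v v"
    using assms by (auto intro: pres_eq.refl)
  then show ?thesis
    unfolding presented_group_def pres_class_def
    by (auto intro: pres_eq.trans pres_eq.cong)
qed

lemma pres_eq_left_inverse:
  assumes "u \<in> lists (X \<times> UNIV)"
  shows "pres_eq X R (rev (map (\<lambda>(x, b). (x, \<not> b)) u) @ u) []"
  using assms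
proof (induction u)
  case Nil
  then show ?case by (simp add: pres_eq.refl)
next
  case (Cons a u)
  obtain x b where a: "a = (x, b)" by force
  let ?v = "rev (map (\<lambda>(x, b). (x, \<not> b)) u)"
  have x: "x \<in> X" and u: "u \<in> lists (X \<times> UNIV)" using Cons.hyps a by auto
  have v: "?v \<in> lists (X \<times> UNIV)" using u by (auto simp: in_lists_conv_set)
  have "pres_eq X R ([(x, \<not> b), (x, b)] @ u) ([] @ u)"
    using pres_eq.cong[OF pres_eq.cancel[OF x, of R "\<not> b"] pres_eq.refl[OF u]] by simp
  then have "pres_eq X R (?v @ ([(x, \<not> b), (x, b)] @ u)) (?v @ ([] @ u))"
    by (rule pres_eq.cong[OF pres_eq.refl[OF v]])
  then show ?case using Cons.IH a by (auto intro: pres_eq.trans)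
qed

lemma group_presented_group: "group (presented_group X R)"
proof -
  let ?W = "lists (X \<times> UNIV)" and ?G = "presented_group X R"
  have append: "u @ v \<in> ?W" if "u \<in> ?W" "v \<in> ?W" for u v
    using that by auto
  show ?thesis
  proof (rule groupI)
    show "\<one>\<^bsub>?G\<^esub> \<in> carrier ?G"
      by (auto simp: presented_group_simps)
  next
    fix A B assume "A \<in> carrier ?G" "B \<in> carrier ?G"
    then show "A \<otimes>\<^bsub>?G\<^esub> B \<in> carrier ?G"
      unfolding presented_group_simps by (elim imageE) (metis append imageI presented_group_mult)
  next
    fix A B C assume "A \<in> carrier ?G" "B \<in> carrier ?G" "C \<in> carrier ?G"
    then show "A \<otimes>\<^bsub>?G\<^esub> B \<otimes>\<^bsub>?G\<^esub> C = A \<otimes>\<^bsub>?G\<^esub> (B \<otimes>\<^bsub>?G\<^esub> C)"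
      unfolding presented_group_simps
      by (elim imageE) (metis append append_assoc presented_group_mult)
  next
    fix A assume "A \<in> carrier ?G"
    then show "\<one>\<^bsub>?G\<^esub> \<otimes>\<^bsub>?G\<^esub> A = A"
      unfolding presented_group_simps
      by (elim imageE) (metis append_Nil lists.Nil presented_group_mult)
  next
    fix A assume "A \<in> carrier ?G"
    then obtain u where u: "u \<in> ?W" and A: "A = pres_class X R u"
      by (auto simp: presented_group_simps)
    let ?v = "rev (map (\<lambda>(x, b). (x, \<not> b)) u)"
    have v: "?v \<in> ?W" using u by (auto simp: in_lists_conv_set)
    have "pres_class X R (?v @ u) = pres_class X R []"
      using pres_class_eq_iff[OF append[OF v u]] pres_eq_left_inverse[OF u] by blast
    then have "pres_class X R ?v \<otimes>\<^bsub>?G\<^esub> A = \<one>\<^bsub>?G\<^esub>"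
      unfolding A presented_group_mult[OF v u] presented_group_simps .
    then show "\<exists>B\<in>carrier ?G. B \<otimes>\<^bsub>?G\<^esub> A = \<one>\<^bsub>?G\<^esub>"
      using v unfolding presented_group_simps by blast
  qed
qed

datatype 'a hnn_gen = Base 'a | Stable

text \<open>The relations of the base group are given by its multiplication table; these imply
  all relations that hold in the base group. The remaining relations are
  \<open>t\<inverse> h t = \<phi>(h)\<close> for \<open>h \<in> H\<close>, where \<open>t\<close> is \<open>Stable\<close>. The subgroup \<open>K = \<phi>(H)\<close> does not
  occur in the presentation.\<close>

definition hnn_rels ::
  "('a, 'b) monoid_scheme \<Rightarrow> 'a set \<Rightarrow> ('a \<Rightarrow> 'a) \<Rightarrow> ('a hnn_gen word \<times> 'a hnn_gen word) set" where
  "hnn_rels L H \<phi> =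
    {([(Base a, True), (Base b, True)], [(Base (a \<otimes>\<^bsub>L\<^esub> b), True)]) |a b.
       a \<in> carrier L \<and> b \<in> carrier L} \<union>
    {([(Stable, False), (Base h, True), (Stable, True)], [(Base (\<phi> h), True)]) |h. h \<in> H}"

definition HNN ::
  "('a, 'b) monoid_scheme \<Rightarrow> 'a set \<Rightarrow> 'a set \<Rightarrow> ('a \<Rightarrow> 'a) \<Rightarrow> 'a hnn_gen word set monoid" where
  "HNN L H K \<phi> = presented_group (insert Stable (Base ` carrier L)) (hnn_rels L H \<phi>)"

definition stable_letter ::
  "('a, 'b) monoid_scheme \<Rightarrow> 'a set \<Rightarrow> 'a set \<Rightarrow> ('a \<Rightarrow> 'a) \<Rightarrow> 'a hnn_gen word set" where
  "stable_letter L H K \<phi> =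
    pres_class (insert Stable (Base ` carrier L)) (hnn_rels L H \<phi>) [(Stable, True)]"

lemma group_HNN: "group (HNN L H K \<phi>)"
  unfolding HNN_def by (rule group_presented_group)

lemma stable_letter_closed: "stable_letter L H K \<phi> \<in> carrier (HNN L H K \<phi>)"
  by (auto simp: stable_letter_def HNN_def presented_group_simps)

text \<open>\<open>Dom H K \<phi> j\<close> is the domain of the \<open>j\<close>-th power of \<open>\<phi>\<close>, for \<open>j \<ge> 1\<close>; there is
  deliberately no equation for \<open>j = 0\<close>.\<close>

fun Dom :: "'a set \<Rightarrow> 'a set \<Rightarrow> ('a \<Rightarrow> 'a) \<Rightarrow> nat \<Rightarrow> 'a set" where
  "Dom H K \<phi> (Suc 0) = H"
| "Dom H K \<phi> (Suc (Suc j)) = {h \<in> H. \<phi> h \<in> Dom H K \<phi> (Suc j) \<inter> K}"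

definition malnormal :: "'a set \<Rightarrow> ('a, 'b) monoid_scheme \<Rightarrow> bool" where
  "malnormal S G \<longleftrightarrow>
    subgroup S G \<and>
    (\<forall>g\<in>carrier G - S. ((g <#\<^bsub>G\<^esub> S) #>\<^bsub>G\<^esub> (inv\<^bsub>G\<^esub> g)) \<inter> S = {\<one>\<^bsub>G\<^esub>})"

end

theory Submission
  imports Defs "HOL-Library.Sublist"
begin

text \<open>
  A relation \<open>g t^n = t^q g\<close> with \<open>n\<close> and \<open>q\<close> nonzero forces \<open>g\<close> to be a power of \<open>t\<close>. On the
  Bass--Serre tree the reason is that \<open>g\<close> maps the axis of \<open>t\<close> to itself. It cannot reverse the
  axis, because every element respects the orientation of the edges, so some \<open>t^(-k) g t^m\<close> fixes a
  ray of the axis pointwise; and the hypothesis on the domains of the powers of \<open>\<phi>\<close> says that only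
  \<open>1\<close> does so. The argument below is this one, written with the normal form
  \<open>r_1 t^(e_1) ... r_k t^(e_k) l\<close>, in which every \<open>r_i\<close> represents a left coset of \<open>H\<close> or \<open>K\<close> and
  \<open>l\<close> is an element of the base group.

  Words act on normal forms from the right. The action respects the defining relations
  (\<open>fold_letter_respects_pres_eq\<close>), and the normal form reached from the empty one by a word
  represents the element given by that word (\<open>state_val_fold\<close>). Replacing \<open>g\<close> by a word \<open>u\<close>
  and raising the relation to the power \<open>N\<close> gives the normal form of one and the same element
  in two ways. Reading \<open>t^(q N) u\<close>, the first \<open>|q| N - |u|\<close> syllables of the normal form are
  \<open>1 t\<^sup>e\<close> with \<open>e\<close> the sign of \<open>q\<close>, because a letter removes at most one syllable
  (\<open>fold_letter_keeps_deep_stack\<close>). Reading \<open>u t^(n N)\<close> with \<open>n > 0\<close>, from some point on every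
  further \<open>t\<close> appends a syllable and leaves the earlier ones alone (\<open>eventually_pushes\<close>).
  Letting \<open>N\<close> grow, \<open>e\<close> is positive and all syllables of \<open>u t\<^sup>i\<close> are \<open>1 t\<close> for large \<open>i\<close>.
  A new syllable with representative \<open>1\<close> means that the final base element lies in \<open>H\<close> and is
  replaced by its image under \<open>\<phi>\<close>. So all powers of \<open>\<phi>\<close> are defined on this element, which is
  therefore \<open>1\<close>, and \<open>g t\<^sup>m = t\<^sup>k\<close> (\<open>absorbed_by_stable\<close>).
\<close>

lemma (in group) intertwines_power:
  assumes "a \<in> carrier G" "b \<in> carrier G" "g \<in> carrier G" "g \<otimes> a = b \<otimes> g"
  shows "g \<otimes> a [^] (n::nat) = b [^] n \<otimes> g"
proof (induction n)
  case (Suc n)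
  have "g \<otimes> a [^] Suc n = (g \<otimes> a [^] n) \<otimes> a" using assms by (simp add: m_assoc)
  also have "\<dots> = b [^] n \<otimes> (g \<otimes> a)" unfolding Suc using assms(1-3) by (simp add: m_assoc)
  also have "\<dots> = b [^] Suc n \<otimes> g" unfolding assms(4) using assms(1-3) by (simp add: m_assoc)
  finally show ?case .
qed (use assms in simp)

lemma (in group) intertwines_inv:
  assumes "a \<in> carrier G" "b \<in> carrier G" "g \<in> carrier G" "g \<otimes> a = b \<otimes> g"
  shows "g \<otimes> inv a = inv b \<otimes> g"
proof -
  have "g \<otimes> inv a = inv b \<otimes> (b \<otimes> g) \<otimes> inv a"
    using assms(1-3) by (simp flip: m_assoc)
  also have "\<dots> = inv b \<otimes> g"
    unfolding assms(4)[symmetric] using assms(1-3) by (simp add: m_assoc)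
  finally show ?thesis .
qed

section \<open>The two associated subgroups\<close>

locale hnn_data = group L for L :: "('a, 'b) monoid_scheme" (structure) +
  fixes H K :: "'a set" and \<phi> :: "'a \<Rightarrow> 'a"
  assumes subgroup_H: "subgroup H L"
    and subgroup_K: "subgroup K L"
    and iso_\<phi>: "\<phi> \<in> iso (L\<lparr>carrier := H\<rparr>) (L\<lparr>carrier := K\<rparr>)"
begin

text \<open>A sign \<open>e\<close> stands for the letter \<open>t\<close> (\<open>True\<close>) or \<open>t\<inverse>\<close> (\<open>False\<close>). The subgroup \<open>edge e\<close>
  consists of the elements that can be moved across that letter from left to right:
  \<open>h t = t \<phi>(h)\<close> for \<open>h \<in> H\<close> and \<open>k t\<inverse> = t\<inverse> \<phi>\<inverse>(k)\<close> for \<open>k \<in> K\<close>. With \<open>cross e\<close> for the resulting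
  map, one step on normal forms is described for both signs at once.\<close>

definition edge :: "bool \<Rightarrow> 'a set" where
  "edge e = (if e then H else K)"

definition cross :: "bool \<Rightarrow> 'a \<Rightarrow> 'a" where
  "cross e = (if e then \<phi> else inv_into H \<phi>)"

lemma subgroup_edge: "subgroup (edge e) L"
  by (simp add: edge_def subgroup_H subgroup_K)

lemma edge_carrier: "h \<in> edge e \<Longrightarrow> h \<in> carrier L"
  by (meson subgroup.mem_carrier subgroup_edge)

lemma bij_\<phi>: "bij_betw \<phi> H K"
  using iso_\<phi> by (simp add: iso_def)

lemma cross_closed: "h \<in> edge e \<Longrightarrow> cross e h \<in> edge (\<not> e)"
  using bij_\<phi> bij_betw_inv_into[OF bij_\<phi>]
  by (auto simp: edge_def cross_def bij_betw_def)

lemma cross_cross: "h \<in> edge e \<Longrightarrow> cross (\<not> e) (cross e h) = h"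
  using bij_\<phi>
  by (auto simp: edge_def cross_def bij_betw_def inv_into_f_f f_inv_into_f)

lemma cross_mult:
  assumes "g \<in> edge e" "h \<in> edge e"
  shows "cross e (g \<otimes> h) = cross e g \<otimes> cross e h"
proof -
  have hom: "\<phi> (x \<otimes> y) = \<phi> x \<otimes> \<phi> y" if "x \<in> H" "y \<in> H" for x y
    using iso_\<phi> that by (auto simp: iso_def hom_def)
  show ?thesis
  proof (cases e)
    case True
    then show ?thesis using assms hom by (simp add: edge_def cross_def)
  next
    case False
    let ?x = "cross e g" and ?y = "cross e h"
    have xy: "?x \<in> H" "?y \<in> H"
      using cross_closed[OF assms(1)] cross_closed[OF assms(2)] False by (auto simp: edge_def)
    have "\<phi> ?x = g" "\<phi> ?y = h"
      using cross_cross[OF assms(1)] cross_cross[OF assms(2)] False by (auto simp: cross_def)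
    then have "g \<otimes> h = cross (\<not> e) (?x \<otimes> ?y)"
      using hom[OF xy] False by (simp add: cross_def)
    moreover have "?x \<otimes> ?y \<in> edge (\<not> e)"
      using xy False subgroup_H by (simp add: edge_def subgroup.m_closed)
    ultimately show ?thesis using cross_cross[of "?x \<otimes> ?y" "\<not> e"] by simp
  qed
qed

lemma cross_one: "cross e \<one> = \<one>"
proof -
  have 1: "\<one> \<in> edge e" by (simp add: subgroup.one_closed subgroup_edge)
  then have "cross e \<one> \<otimes> cross e \<one> = cross e \<one>"
    using cross_mult[OF 1 1] by simp
  then show ?thesis using cross_closed[OF 1] edge_carrier by (metis l_cancel_one)
qed

text \<open>The trivial coset is represented by \<open>\<one>\<close>, so that a representative lies in \<open>edge e\<close> only if
  it is \<open>\<one>\<close>; powers of \<open>t\<close> are then their own normal forms.\<close>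

definition rep :: "bool \<Rightarrow> 'a \<Rightarrow> 'a" where
  "rep e l = (if l \<in> edge e then \<one> else SOME r. r \<in> l <# edge e)"

lemma rep_in_coset:
  assumes "l \<in> carrier L"
  shows "rep e l \<in> l <# edge e"
proof (cases "l \<in> edge e")
  case True
  have "l \<otimes> inv l \<in> l <# edge e"
    using True subgroup_edge[of e] by (auto simp: l_coset_def subgroup.m_inv_closed)
  then show ?thesis using True assms by (simp add: rep_def)
next
  case False
  have "l \<otimes> \<one> \<in> l <# edge e"
    using subgroup_edge[of e] by (auto simp: l_coset_def subgroup.one_closed)
  then show ?thesis using False by (simp add: rep_def) (metis someI)
qed

lemma rep_closed: "l \<in> carrier L \<Longrightarrow> rep e l \<in> carrier L"
  using rep_in_coset[of l e] edge_carrier by (auto simp: l_coset_def)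

lemma rep_remainder:
  assumes "l \<in> carrier L"
  shows "inv (rep e l) \<otimes> l \<in> edge e"
proof -
  obtain h where h: "h \<in> edge e" "rep e l = l \<otimes> h"
    using rep_in_coset[OF assms] by (auto simp: l_coset_def)
  have "inv (rep e l) \<otimes> l = inv h"
    using h assms edge_carrier[OF h(1)] by (simp add: inv_mult_group m_assoc)
  then show ?thesis using h(1) by (simp add: subgroup.m_inv_closed subgroup_edge)
qed

lemma mult_edge_iff:
  assumes "l \<in> carrier L" "h \<in> edge e"
  shows "l \<otimes> h \<in> edge e \<longleftrightarrow> l \<in> edge e"
proof
  assume "l \<otimes> h \<in> edge e"
  then have "(l \<otimes> h) \<otimes> inv h \<in> edge e"
    using assms subgroup_edge by (simp add: subgroup.m_closed subgroup.m_inv_closed)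
  then show "l \<in> edge e"
    using assms edge_carrier by (simp add: m_assoc)
next
  assume "l \<in> edge e"
  then show "l \<otimes> h \<in> edge e"
    using assms subgroup_edge by (simp add: subgroup.m_closed)
qed

lemma rep_mult:
  assumes "l \<in> carrier L" "h \<in> edge e"
  shows "rep e (l \<otimes> h) = rep e l"
proof -
  have "l \<otimes> h \<in> l <# edge e" using assms by (auto simp: l_coset_def)
  then have "(l \<otimes> h) <# edge e = l <# edge e"
    using l_repr_independence[OF _ assms(1) subgroup_edge] by simp
  then show ?thesis using mult_edge_iff[OF assms] by (simp add: rep_def)
qed

lemma rep_split: "l \<in> carrier L \<Longrightarrow> rep e l \<otimes> (inv (rep e l) \<otimes> l) = l"
  using rep_closed[of l e] by (simp flip: m_assoc)

lemma rep_rep: "l \<in> carrier L \<Longrightarrow> rep e (rep e l) = rep e l"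
  using rep_mult[OF rep_closed rep_remainder, of l l e e] rep_split by simp

lemma rep_in_edge_iff: "l \<in> carrier L \<Longrightarrow> rep e l \<in> edge e \<longleftrightarrow> l \<in> edge e"
  using mult_edge_iff[OF rep_closed rep_remainder, of l l e e] rep_split by simp

lemma rep_edge: "l \<in> edge e \<Longrightarrow> rep e l = \<one>"
  by (simp add: rep_def)

section \<open>The action on normal forms\<close>

text \<open>The pair \<open>(s, l)\<close> encodes a normal form that ends in the base element \<open>l\<close>. The syllables are
  the entries of the stack \<open>s\<close>, with the last syllable at the head, where multiplication on the
  right by a letter takes place. Either the letter cancels against the last syllable, or
  \<open>l t\<^sup>e\<close> is written as \<open>r t\<^sup>e l'\<close> with a coset representative \<open>r\<close>.\<close>

fun pops :: "bool \<Rightarrow> ('a \<times> bool) list \<times> 'a \<Rightarrow> bool" where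
  "pops e (s, l) \<longleftrightarrow> s \<noteq> [] \<and> snd (hd s) = (\<not> e) \<and> l \<in> edge e"

fun step :: "bool \<Rightarrow> ('a \<times> bool) list \<times> 'a \<Rightarrow> ('a \<times> bool) list \<times> 'a" where
  "step e (s, l) =
    (if pops e (s, l) then (tl s, fst (hd s) \<otimes> cross e l)
     else ((rep e l, e) # s, cross e (inv (rep e l) \<otimes> l)))"

fun reduced :: "('a \<times> bool) list \<Rightarrow> bool" where
  "reduced [] \<longleftrightarrow> True"
| "reduced ((r, e) # s) \<longleftrightarrow> r \<in> carrier L \<and> rep e r = r \<and>
     (s \<noteq> [] \<and> snd (hd s) = (\<not> e) \<longrightarrow> r \<notin> edge e) \<and> reduced s"

definition states :: "(('a \<times> bool) list \<times> 'a) set" where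
  "states = {(s, l). reduced s \<and> l \<in> carrier L}"

lemma step_states:
  assumes "x \<in> states"
  shows "step e x \<in> states"
proof -
  obtain s l where x: "x = (s, l)" and s: "reduced s" and l: "l \<in> carrier L"
    using assms by (auto simp: states_def)
  show ?thesis
  proof (cases "pops e x")
    case True
    then obtain r s' where s': "s = (r, \<not> e) # s'" and lA: "l \<in> edge e"
      unfolding x by (cases s) auto
    then show ?thesis
      using x s True edge_carrier[OF cross_closed[OF lA]] by (simp add: states_def)
  next
    case False
    then show ?thesis
      using x s l rep_closed rep_rep rep_in_edge_iff
        edge_carrier[OF cross_closed[OF rep_remainder[OF l]]]
      by (auto simp: states_def)
  qed
qed

text \<open>A cancellation is undone by appending the cancelled syllable again: otherwise the entry below
  would cancel too, and the cancelled representative would lie in \<open>edge (\<not> e)\<close> between letters of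
  opposite signs, which a reduced stack excludes. An appended syllable is undone by cancelling it.\<close>

lemma step_step:
  assumes "x \<in> states"
  shows "step (\<not> e) (step e x) = x"
proof -
  obtain s l where x: "x = (s, l)" and s: "reduced s" and l: "l \<in> carrier L"
    using assms by (auto simp: states_def)
  show ?thesis
  proof (cases "pops e x")
    case True
    then obtain r s' where s': "s = (r, \<not> e) # s'" and lA: "l \<in> edge e"
      unfolding x by (cases s) auto
    have r: "r \<in> carrier L" "rep (\<not> e) r = r" using s s' by auto
    have p: "cross e l \<in> edge (\<not> e)" using cross_closed[OF lA] .
    have "\<not> pops (\<not> e) (s', r \<otimes> cross e l)"
      using s s' mult_edge_iff[OF r(1) p] by auto
    moreover have "rep (\<not> e) (r \<otimes> cross e l) = r"
      using rep_mult[OF r(1) p] r by simp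
    moreover have "inv r \<otimes> (r \<otimes> cross e l) = cross e l"
      using r edge_carrier[OF p] by (simp flip: m_assoc)
    ultimately show ?thesis
      using True x s' cross_cross[OF lA] by auto
  next
    case False
    then show ?thesis
      using x cross_closed[OF rep_remainder[OF l]] cross_cross[OF rep_remainder[OF l]] rep_split[OF l]
      by auto
  qed
qed

text \<open>On normal forms this is the relation \<open>h t\<^sup>e = t\<^sup>e h'\<close>: \<open>l\<close> and \<open>l h\<close> lie in the same
  left coset, so they cancel together or have the same representative, and \<open>h\<close> only affects what
  is left behind the letter.\<close>

lemma step_mult_edge:
  assumes "(s, l) \<in> states" "h \<in> edge e" "step e (s, l) = (s', l')"
  shows "step e (s, l \<otimes> h) = (s', l' \<otimes> cross e h)"
proof (cases "pops e (s, l)")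
  case True
  then obtain r s' where s': "s = (r, \<not> e) # s'" and lA: "l \<in> edge e"
    by (cases s) auto
  have "l \<otimes> h \<in> edge e" using lA assms(2) by (simp add: subgroup.m_closed subgroup_edge)
  moreover have "r \<in> carrier L" using assms(1) s' by (simp add: states_def)
  ultimately show ?thesis
    using assms(2,3) s' lA cross_mult[OF lA assms(2)]
      edge_carrier[OF cross_closed[OF lA]] edge_carrier[OF cross_closed[OF assms(2)]]
    by (auto simp: m_assoc)
next
  case False
  have l: "l \<in> carrier L" using assms(1) by (simp add: states_def)
  have "inv (rep e l) \<otimes> (l \<otimes> h) = (inv (rep e l) \<otimes> l) \<otimes> h"
    using l rep_closed[OF l] edge_carrier[OF assms(2)] by (simp add: m_assoc)
  then show ?thesis
    using False assms(2,3) mult_edge_iff[OF l assms(2)] rep_mult[OF l assms(2)]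
      cross_mult[OF rep_remainder[OF l] assms(2)]
    by auto
qed

fun letter :: "'a hnn_gen \<times> bool \<Rightarrow> ('a \<times> bool) list \<times> 'a \<Rightarrow> ('a \<times> bool) list \<times> 'a" where
  "letter (Base a, b) (s, l) = (s, l \<otimes> (if b then a else inv a))"
| "letter (Stable, e) x = step e x"

abbreviation gens :: "'a hnn_gen set" where
  "gens \<equiv> insert Stable (Base ` carrier L)"

abbreviation hnn_words :: "'a hnn_gen word set" where
  "hnn_words \<equiv> lists (gens \<times> UNIV)"

lemma letter_states: "c \<in> gens \<times> UNIV \<Longrightarrow> x \<in> states \<Longrightarrow> letter c x \<in> states"
  using step_states[of x "snd c"]
  by (cases c; cases "fst c"; cases x) (auto simp: states_def simp del: step.simps)

lemma fold_letter_states: "u \<in> hnn_words \<Longrightarrow> x \<in> states \<Longrightarrow> fold letter u x \<in> states"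
proof (induction u arbitrary: x)
  case (Cons c u)
  then show ?case using letter_states[of c x] by simp
qed simp

text \<open>The action of words thus descends to the HNN extension. The relation \<open>t\<inverse> h t = \<phi>(h)\<close> is the
  only one that takes work: it follows from \<open>h t = t \<phi>(h)\<close> because \<open>t\<inverse>\<close> and \<open>t\<close> act as inverse
  permutations.\<close>

lemma fold_letter_respects_pres_eq:
  assumes "pres_eq gens (hnn_rels L H \<phi>) u v" "x \<in> states"
  shows "fold letter u x = fold letter v x"
  using assms
proof (induction arbitrary: x)
  case (rel u v)
  obtain s l where x: "x = (s, l)" and l: "l \<in> carrier L"
    using rel.prems by (auto simp: states_def)
  from rel.hyps(1) consider
    (table) a b where "a \<in> carrier L" "b \<in> carrier L"
      "u = [(Base a, True), (Base b, True)]" "v = [(Base (a \<otimes> b), True)]"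
    | (conj) h where "h \<in> H"
      "u = [(Stable, False), (Base h, True), (Stable, True)]" "v = [(Base (\<phi> h), True)]"
    unfolding hnn_rels_def by blast
  then show ?case
  proof cases
    case table
    then show ?thesis using x l by (simp add: m_assoc)
  next
    case conj
    obtain s' l' where y: "step False x = (s', l')" by force
    have "(s', l') \<in> states" using step_states[OF rel.prems, of False] y by simp
    moreover have "step True (s', l') = (s, l)"
      using step_step[OF rel.prems, of False] y x by simp
    ultimately have "step True (s', l' \<otimes> h) = (s, l \<otimes> \<phi> h)"
      using step_mult_edge[of s' l' h True s l] conj(1) by (simp add: edge_def cross_def)
    then show ?thesis using conj x y by (simp del: step.simps)
  qed
next
  case (cancel y b)
  obtain s l where x: "x = (s, l)" and l: "l \<in> carrier L"
    using cancel.prems by (auto simp: states_def)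
  show ?case
  proof (cases y)
    case (Base a)
    then show ?thesis using cancel.hyps x l by (auto simp: m_assoc)
  next
    case Stable
    then show ?thesis using step_step[OF cancel.prems] by (simp del: step.simps)
  qed
next
  case (cong u u' v v')
  have "u' \<in> hnn_words" using pres_eq_words[OF cong.hyps(1)] by blast
  then show ?case using cong fold_letter_states[of u' x] by simp
qed auto

section \<open>Normal forms represent the elements of the HNN extension\<close>

abbreviation G :: "'a hnn_gen word set monoid" where
  "G \<equiv> HNN L H K \<phi>"

abbreviation cls :: "'a hnn_gen word \<Rightarrow> 'a hnn_gen word set" where
  "cls \<equiv> pres_class gens (hnn_rels L H \<phi>)"

sublocale G: group G
  by (rule group_HNN)

lemma cls_closed: "u \<in> hnn_words \<Longrightarrow> cls u \<in> carrier G"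
  by (auto simp: HNN_def presented_group_simps)

lemma cls_append:
  "u \<in> hnn_words \<Longrightarrow> v \<in> hnn_words \<Longrightarrow> cls (u @ v) = cls u \<otimes>\<^bsub>G\<^esub> cls v"
  by (simp add: HNN_def presented_group_mult)

lemma cls_Nil: "cls [] = \<one>\<^bsub>G\<^esub>"
  by (simp add: HNN_def presented_group_simps)

lemma cls_eqI: "pres_eq gens (hnn_rels L H \<phi>) u v \<Longrightarrow> cls u = cls v"
  using pres_class_eq_iff pres_eq_words by metis

lemma carrier_obtain_word:
  assumes "g \<in> carrier G"
  obtains u where "u \<in> hnn_words" "g = cls u"
  using assms by (auto simp: HNN_def presented_group_simps)

lemma cls_cancel: "y \<in> gens \<Longrightarrow> cls [(y, b)] \<otimes>\<^bsub>G\<^esub> cls [(y, \<not> b)] = \<one>\<^bsub>G\<^esub>"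
  using cls_append[of "[(y, b)]" "[(y, \<not> b)]"] cls_eqI[OF pres_eq.cancel, of y b] cls_Nil
  by simp

abbreviation base :: "'a \<Rightarrow> 'a hnn_gen word set" where
  "base a \<equiv> cls [(Base a, True)]"

abbreviation stable :: "bool \<Rightarrow> 'a hnn_gen word set" where
  "stable e \<equiv> cls [(Stable, e)]"

lemma base_closed: "a \<in> carrier L \<Longrightarrow> base a \<in> carrier G"
  by (simp add: cls_closed)

lemma stable_closed: "stable e \<in> carrier G"
  by (simp add: cls_closed)

lemma base_mult:
  assumes "a \<in> carrier L" "b \<in> carrier L"
  shows "base (a \<otimes> b) = base a \<otimes>\<^bsub>G\<^esub> base b"
proof -
  have "pres_eq gens (hnn_rels L H \<phi>) [(Base a, True), (Base b, True)] [(Base (a \<otimes> b), True)]"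
    by (rule pres_eq.rel) (use assms in \<open>auto simp: hnn_rels_def\<close>)
  then show ?thesis
    using cls_eqI cls_append[of "[(Base a, True)]" "[(Base b, True)]"] assms by simp
qed

lemma base_one: "base \<one> = \<one>\<^bsub>G\<^esub>"
  using base_mult[of \<one> \<one>] base_closed[of \<one>] G.l_cancel_one[of "base \<one>" "base \<one>"] by simp

lemma cls_Base_False: 
  assumes "a \<in> carrier L"
  shows "cls [(Base a, False)] = base (inv a)"
proof -
  have "cls [(Base a, False)] \<otimes>\<^bsub>G\<^esub> base a = \<one>\<^bsub>G\<^esub>"
    using cls_cancel[of "Base a" False] assms by simp
  moreover have "base (inv a) \<otimes>\<^bsub>G\<^esub> base a = \<one>\<^bsub>G\<^esub>"
    using assms by (simp add: base_one flip: base_mult)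
  ultimately show ?thesis
    using assms G.right_cancel[of "base a" "cls [(Base a, False)]" "base (inv a)"]
    by (simp add: cls_closed)
qed

lemma stable_cancel: "stable e \<otimes>\<^bsub>G\<^esub> stable (\<not> e) = \<one>\<^bsub>G\<^esub>"
  by (simp add: cls_cancel)

lemma stable_cancel_left:
  "g \<in> carrier G \<Longrightarrow> stable e \<otimes>\<^bsub>G\<^esub> (stable (\<not> e) \<otimes>\<^bsub>G\<^esub> g) = g"
  by (simp add: stable_cancel stable_closed flip: G.m_assoc)

lemma stable_False_eq_inv: "stable False = inv\<^bsub>G\<^esub> stable True"
  using stable_cancel[of False] by (simp add: G.inv_equality stable_closed)

text \<open>For \<open>e = False\<close> this is the relation for \<open>e = True\<close>, multiplied by \<open>t\<inverse>\<close> on both sides.\<close>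

lemma base_stable:
  assumes "h \<in> edge e"
  shows "base h \<otimes>\<^bsub>G\<^esub> stable e = stable e \<otimes>\<^bsub>G\<^esub> base (cross e h)"
proof -
  have conj: "base k \<otimes>\<^bsub>G\<^esub> stable True = stable True \<otimes>\<^bsub>G\<^esub> base (\<phi> k)" if k: "k \<in> H" for k
  proof -
    have kc: "k \<in> carrier L" "\<phi> k \<in> carrier L"
      using k edge_carrier[of k True] edge_carrier[OF cross_closed, of k True]
      by (auto simp: edge_def cross_def)
    have "pres_eq gens (hnn_rels L H \<phi>)
        [(Stable, False), (Base k, True), (Stable, True)] [(Base (\<phi> k), True)]"
      by (rule pres_eq.rel) (use k kc in \<open>auto simp: hnn_rels_def\<close>)
    then have "base (\<phi> k) = stable False \<otimes>\<^bsub>G\<^esub> (base k \<otimes>\<^bsub>G\<^esub> stable True)"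
      using kc cls_eqI cls_append[of "[(Base k, True)]" "[(Stable, True)]"]
        cls_append[of "[(Stable, False)]" "[(Base k, True), (Stable, True)]"] by simp
    then show ?thesis
      using stable_cancel_left[of "base k \<otimes>\<^bsub>G\<^esub> stable True" True] kc
      by (simp add: stable_closed base_closed)
  qed
  show ?thesis
  proof (cases e)
    case True
    then show ?thesis using conj assms by (simp add: edge_def cross_def)
  next
    case False
    let ?k = "cross e h"
    have k: "?k \<in> H" "\<phi> ?k = h" "?k \<in> carrier L" "h \<in> carrier L"
      using cross_closed[OF assms] cross_cross[OF assms] False edge_carrier[OF assms]
        edge_carrier[OF cross_closed[OF assms]]
      by (auto simp: edge_def cross_def)
    have "stable False \<otimes>\<^bsub>G\<^esub> base ?k = 
        stable False \<otimes>\<^bsub>G\<^esub> (base ?k \<otimes>\<^bsub>G\<^esub> stable True) \<otimes>\<^bsub>G\<^esub> stable False"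
      using k stable_cancel[of True] by (simp add: G.m_assoc base_closed stable_closed)
    also have "\<dots> = base h \<otimes>\<^bsub>G\<^esub> stable False"
      unfolding conj[OF k(1)] using k stable_cancel_left[of "base h" False]
      by (simp add: base_closed stable_closed)
    finally show ?thesis using False by simp
  qed
qed

fun stack_val :: "('a \<times> bool) list \<Rightarrow> 'a hnn_gen word set" where
  "stack_val [] = \<one>\<^bsub>G\<^esub>"
| "stack_val ((r, e) # s) = stack_val s \<otimes>\<^bsub>G\<^esub> (base r \<otimes>\<^bsub>G\<^esub> stable e)"

definition state_val :: "('a \<times> bool) list \<times> 'a \<Rightarrow> 'a hnn_gen word set" where
  "state_val x = stack_val (fst x) \<otimes>\<^bsub>G\<^esub> base (snd x)"

lemma stack_val_closed: "reduced s \<Longrightarrow> stack_val s \<in> carrier G"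
  by (induction s rule: reduced.induct) (auto simp: base_closed stable_closed)

lemma state_val_step:
  assumes "x \<in> states"
  shows "state_val (step e x) = state_val x \<otimes>\<^bsub>G\<^esub> stable e"
proof -
  obtain s l where x: "x = (s, l)" and s: "reduced s" and l: "l \<in> carrier L"
    using assms by (auto simp: states_def)
  note closed = base_closed stable_closed stack_val_closed
  show ?thesis
  proof (cases "pops e x")
    case True
    then obtain r s' where s': "s = (r, \<not> e) # s'" and lA: "l \<in> edge e"
      unfolding x by (cases s) auto
    have r: "r \<in> carrier L" "reduced s'" using s s' by auto
    have p: "cross e l \<in> carrier L" using edge_carrier[OF cross_closed[OF lA]] .
    have "state_val x \<otimes>\<^bsub>G\<^esub> stable e =
      stack_val s' \<otimes>\<^bsub>G\<^esub> (base r \<otimes>\<^bsub>G\<^esub> (stable (\<not> e) \<otimes>\<^bsub>G\<^esub> (base l \<otimes>\<^bsub>G\<^esub> stable e)))"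
      using x s' r l by (simp add: state_val_def G.m_assoc closed)
    also have "\<dots> = stack_val s' \<otimes>\<^bsub>G\<^esub> (base r \<otimes>\<^bsub>G\<^esub> base (cross e l))"
      using base_stable[OF lA] stable_cancel_left[of "base (cross e l)" "\<not> e"] p
      by (simp add: closed)
    also have "\<dots> = state_val (step e x)"
      using True x s' r p by (simp add: state_val_def base_mult)
    finally show ?thesis by simp
  next
    case False
    let ?r = "rep e l" and ?h = "inv (rep e l) \<otimes> l"
    have h: "?h \<in> edge e" using rep_remainder[OF l] .
    have p: "cross e ?h \<in> carrier L" using edge_carrier[OF cross_closed[OF h]] .
    have r: "?r \<in> carrier L" using rep_closed[OF l] .
    have hc: "?h \<in> carrier L" using edge_carrier[OF h] .
    have "state_val x \<otimes>\<^bsub>G\<^esub> stable e = stack_val s \<otimes>\<^bsub>G\<^esub> (base (?r \<otimes> ?h) \<otimes>\<^bsub>G\<^esub> stable e)"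
      using x s l rep_split[OF l] by (simp add: state_val_def G.m_assoc closed)
    also have "\<dots> = stack_val s \<otimes>\<^bsub>G\<^esub> (base ?r \<otimes>\<^bsub>G\<^esub> (base ?h \<otimes>\<^bsub>G\<^esub> stable e))"
      unfolding base_mult[OF r hc] using r hc s by (simp add: G.m_assoc closed del: m_closed)
    also have "\<dots> = stack_val s \<otimes>\<^bsub>G\<^esub> (base ?r \<otimes>\<^bsub>G\<^esub> (stable e \<otimes>\<^bsub>G\<^esub> base (cross e ?h)))"
      by (simp only: base_stable[OF h])
    also have "\<dots> = state_val (step e x)"
      using False x s r p by (auto simp: state_val_def G.m_assoc closed)
    finally show ?thesis by simp
  qed
qed

lemma state_val_letter:
  assumes "c \<in> gens \<times> UNIV" "x \<in> states"
  shows "state_val (letter c x) = state_val x \<otimes>\<^bsub>G\<^esub> cls [c]"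
proof -
  obtain y b where c: "c = (y, b)" by force
  obtain s l where x: "x = (s, l)" and s: "reduced s" and l: "l \<in> carrier L"
    using assms by (auto simp: states_def)
  show ?thesis
  proof (cases y)
    case (Base a)
    then have a: "a \<in> carrier L" using assms c by auto
    then have "cls [c] = base (if b then a else inv a)"
      using Base c cls_Base_False by simp
    then show ?thesis
      using Base c x a l s
      by (simp add: state_val_def base_mult G.m_assoc base_closed stack_val_closed)
  next
    case Stable
    then show ?thesis using c state_val_step[OF assms(2)] by (simp del: step.simps)
  qed
qed

text \<open>Applied to the empty normal form, this recovers an element from its normal form; it is what
  turns a computation of normal forms into an equation in the HNN extension.\<close>

lemma state_val_fold:
  assumes "u \<in> hnn_words" "x \<in> states"
  shows "state_val (fold letter u x) = state_val x \<otimes>\<^bsub>G\<^esub> cls u"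
  using assms
proof (induction u arbitrary: x)
  case Nil
  then show ?case
    by (auto simp: cls_Nil states_def state_val_def base_closed stack_val_closed)
next
  case (Cons c u)
  have val: "state_val x \<in> carrier G"
    using Cons.prems by (auto simp: states_def state_val_def base_closed stack_val_closed)
  have "cls (c # u) = cls [c] \<otimes>\<^bsub>G\<^esub> cls u"
    using cls_append[of "[c]" u] Cons by simp
  then show ?case
    using Cons letter_states[of c x] state_val_letter[of c x] val
    by (simp add: G.m_assoc cls_closed)
qed

section \<open>Stacks along powers of the stable letter\<close>

lemma origin_states: "([], \<one>) \<in> states"
  by (simp add: states_def)

lemma fold_letter_stable: "fold letter (replicate n (Stable, e)) x = (step e ^^ n) x"
  by (induction n arbitrary: x) (simp_all add: funpow_swap1 del: step.simps)

lemma replicate_stable_words: "replicate n (Stable, e) \<in> hnn_words"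
  by (auto simp: in_lists_conv_set)

lemma cls_replicate_stable: "cls (replicate n (Stable, e)) = stable e [^]\<^bsub>G\<^esub> n"
proof (induction n)
  case (Suc n)
  then show ?case
    using cls_append[OF replicate_stable_words[of n e], of "[(Stable, e)]"]
    by (simp add: replicate_append_same)
qed (simp add: cls_Nil)

lemma one_in_edge: "\<one> \<in> edge e"
  by (simp add: subgroup.one_closed subgroup_edge)

lemma step_power_origin: "(step e ^^ n) ([], \<one>) = (replicate n (\<one>, e), \<one>)"
  by (induction n) (auto simp: rep_edge cross_one one_in_edge)

lemma suffix_drop_le: "m \<le> n \<Longrightarrow> suffix (drop n xs) (drop m xs)"
  using suffix_drop[of "n - m" "drop m xs"] by simp

lemma letter_keeps_deep_stack:
  "suffix (drop 1 (fst x)) (fst (letter c x))"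
proof -
  obtain y b s l where "c = (y, b)" "x = (s, l)" by (metis surj_pair)
  then show ?thesis
    by (cases y) (auto simp: suffix_ConsI drop_Suc)
qed

text \<open>Every letter removes at most one syllable, so that a word \<open>u\<close> leaves all but the last \<open>|u|\<close>
  syllables in place, whatever it writes after them.\<close>

lemma fold_letter_keeps_deep_stack:
  "suffix (drop (length u) (fst x)) (fst (fold letter u x))"
proof (induction u arbitrary: x)
  case (Cons c u)
  obtain ys where ys: "fst (letter c x) = ys @ drop 1 (fst x)"
    using letter_keeps_deep_stack[of x c] by (auto simp: suffix_def)
  have "suffix (drop (length u) (drop 1 (fst x))) (drop (length u) (ys @ drop 1 (fst x)))"
    unfolding drop_append by (intro suffix_appendI suffix_drop_le) simp
  also have "suffix (drop (length u) (ys @ drop 1 (fst x))) (fst (fold letter (c # u) x))"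
    using Cons[of "letter c x"] ys by simp
  finally show ?case by simp
qed simp

text \<open>Cancellations shorten the stack, so they cannot go on for ever; after the first appended
  syllable the top sign is \<open>True\<close>, and another \<open>t\<close> does not cancel against it.\<close>

lemma eventually_pushes:
  obtains m where "\<And>i. m \<le> i \<Longrightarrow> \<not> pops True ((step True ^^ i) x)"
proof -
  let ?x = "\<lambda>i. (step True ^^ i) x"
  have "\<exists>m. \<not> pops True (?x m)"
  proof (rule ccontr)
    assume "\<nexists>m. \<not> pops True (?x m)"
    then have pops: "pops True (?x i)" for i by blast
    have "length (fst (?x i)) + i = length (fst x)" for i
    proof (induction i)
      case (Suc i)
      obtain s l where sl: "?x i = (s, l)" by force
      then have "s \<noteq> []" using pops[of i] by simp
      then show ?case using Suc pops[of i] sl by (cases s) auto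
    qed simp
    from this[of "Suc (length (fst x))"] show False by simp
  qed
  then obtain m where m: "\<not> pops True (?x m)" by blast
  have "\<not> pops True (?x i)" if "m \<le> i" for i
    using that
  proof (induction i rule: dec_induct)
    case (step i)
    obtain s l where "?x i = (s, l)" by force
    then show ?case using step.IH by (auto split: if_splits)
  qed (rule m)
  then show ?thesis by (rule that)
qed

lemma Dom_if_orbit:
  assumes "\<And>i. (\<phi> ^^ i) l \<in> H"
  shows "l \<in> Dom H K \<phi> (Suc j)"
  using assms
proof (induction j arbitrary: l)
  case 0
  then show ?case using 0[of 0] by simp
next
  case (Suc j)
  have "(\<phi> ^^ i) (\<phi> l) \<in> H" for i
    using Suc.prems[of "Suc i"] by (simp add: funpow_swap1)
  then have "\<phi> l \<in> Dom H K \<phi> (Suc j)" by (rule Suc.IH)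
  moreover have "l \<in> H" using Suc.prems[of 0] by simp
  ultimately show ?case using bij_\<phi> by (auto simp: bij_betw_def)
qed

lemma suffix_replicate_imp:
  assumes "suffix s (replicate n a)"
  shows "s = replicate (length s) a"
  using set_mono_suffix[OF assms] by (intro replicate_length_same[symmetric]) auto

section \<open>Malnormality\<close>

text \<open>Here the two readings of the normal form are compared: \<open>x i\<close> is the normal form of \<open>u t\<^sup>i\<close>.
  The stack of \<open>x i\<close> for large \<open>i\<close> is an initial piece of the normal form of \<open>u t^(n N)\<close> for all large
  \<open>N\<close>, hence of \<open>t^e t^e ...\<close>.\<close>

lemma absorbed_by_stable:
  assumes u: "u \<in> hnn_words" and n: "0 < n" and q: "0 < q"
    and comm: "\<And>N. cls (u @ replicate (n * N) (Stable, True)) =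
      cls (replicate (q * N) (Stable, e) @ u)"
    and dom: "\<And>l. l \<in> carrier L \<Longrightarrow> l \<noteq> \<one> \<Longrightarrow> \<exists>j>0. l \<notin> Dom H K \<phi> j"
  shows "\<exists>m k. cls u \<otimes>\<^bsub>G\<^esub> stable True [^]\<^bsub>G\<^esub> (m::nat) = stable True [^]\<^bsub>G\<^esub> (k::nat)"
proof -
  define x where "x i = (step True ^^ i) (fold letter u ([], \<one>))" for i
  have x_fold: "x i = fold letter (u @ replicate i (Stable, True)) ([], \<one>)" for i
    by (simp only: x_def fold_append comp_apply fold_letter_stable)
  have x_Suc: "x (Suc i) = step True (x i)" for i by (simp add: x_def)
  have x_states: "x i \<in> states" for i
    unfolding x_fold
    by (rule fold_letter_states) (use u replicate_stable_words in \<open>auto simp: origin_states\<close>)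
  obtain m where m: "\<And>i. m \<le> i \<Longrightarrow> \<not> pops True (x i)"
    unfolding x_def by (rule eventually_pushes) blast
  have pushes: "x (Suc i) = ((rep True (snd (x i)), True) # fst (x i),
      \<phi> (inv (rep True (snd (x i))) \<otimes> snd (x i)))" if "m \<le> i" for i
    using m[OF that] x_Suc[of i] by (cases "x i") (auto simp: cross_def)
  have grow: "suffix (fst (x i)) (fst (x j)) \<and> length (fst (x j)) + i = length (fst (x i)) + j"
    if "m \<le> i" "i \<le> j" for i j
    using that(2)
  proof (induction j rule: dec_induct)
    case (step j)
    then show ?case using pushes[of j] that(1) by (auto intro: suffix_ConsI)
  qed simp
  have deep: "suffix (replicate (q * N - length u) (\<one>, e)) (fst (x (n * N)))" for N
  proof -
    have w: "u @ replicate (n * N) (Stable, True) \<in> hnn_words"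
      using u replicate_stable_words by auto
    have "pres_eq gens (hnn_rels L H \<phi>)
        (u @ replicate (n * N) (Stable, True)) (replicate (q * N) (Stable, e) @ u)"
      using comm pres_class_eq_iff[OF w] by blast
    then have "x (n * N) = fold letter (replicate (q * N) (Stable, e) @ u) ([], \<one>)"
      unfolding x_fold by (rule fold_letter_respects_pres_eq[OF _ origin_states])
    also have "\<dots> = fold letter u (replicate (q * N) (\<one>, e), \<one>)"
      by (simp only: fold_append comp_apply fold_letter_stable step_power_origin)
    finally show ?thesis
      using fold_letter_keeps_deep_stack[of u "(replicate (q * N) (\<one>, e), \<one>)"] by simp
  qed
  have stack: "fst (x i) = replicate (length (fst (x i))) (\<one>, e)" if i: "m \<le> i" for i
  proof -
    \<comment> \<open>\<open>N\<close> is so large that \<open>u t^(n N)\<close> extends \<open>u t\<^sup>i\<close> and the part of \<open>t^(q N)\<close> that survives \<open>u\<close> covers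
      the stack of \<open>x i\<close>.\<close>
    define N where "N = i + length (fst (x i)) + length u"
    have "N \<le> n * N" "N \<le> q * N" using n q by auto
    moreover have "i \<le> N" "length (fst (x i)) \<le> N - length u" by (simp_all add: N_def)
    ultimately have "i \<le> n * N" "length (fst (x i)) \<le> q * N - length u" by linarith+
    then have "suffix (fst (x i)) (replicate (q * N - length u) (\<one>, e))"
      using suffix_length_suffix[OF conjunct1[OF grow[OF i]] deep, of N] by simp
    then show ?thesis by (rule suffix_replicate_imp)
  qed
  \<comment> \<open>The sign of the constant syllable is read off the syllable that the last \<open>t\<close> appended.\<close>
  have top: "rep True (snd (x i)) = \<one> \<and> e" if i: "m \<le> i" for i
  proof -
    have "(rep True (snd (x i)), True) \<in> set (fst (x (Suc i)))"
      using pushes[OF i] by simp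
    then show ?thesis using stack[of "Suc i"] i by (metis in_set_replicate le_SucI prod.inject)
  qed
  have in_H: "snd (x i) \<in> H" and next_l: "snd (x (Suc i)) = \<phi> (snd (x i))" if i: "m \<le> i" for i
  proof -
    have l: "snd (x i) \<in> carrier L" using x_states[of i] by (auto simp: states_def)
    show "snd (x i) \<in> H"
      using rep_in_edge_iff[OF l, of True] top[OF i] one_in_edge[of True] by (simp add: edge_def)
    show "snd (x (Suc i)) = \<phi> (snd (x i))" using pushes[OF i] top[OF i] l by simp
  qed
  have "snd (x (m + i)) = (\<phi> ^^ i) (snd (x m))" for i
    by (induction i) (simp_all add: next_l)
  then have "(\<phi> ^^ i) (snd (x m)) \<in> H" for i
    using in_H[of "m + i"] by simp
  then have "snd (x m) \<in> Dom H K \<phi> j" if "j > 0" for j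
    using Dom_if_orbit that by (metis gr0_implies_Suc)
  then have "snd (x m) = \<one>"
    using dom[of "snd (x m)"] x_states[of m] by (fastforce simp: states_def)
  moreover have "fst (x m) = replicate (length (fst (x m))) (\<one>, True)"
    using stack[of m] top[of m] by simp
  ultimately obtain k where k: "x m = (replicate k (\<one>, True), \<one>)"
    by (intro that[of "length (fst (x m))"] prod_eqI) simp_all
  then have xm: "x m = fold letter (replicate k (Stable, True)) ([], \<one>)"
    by (simp only: fold_letter_stable step_power_origin)
  have origin_val: "state_val ([], \<one>) = \<one>\<^bsub>G\<^esub>"
    by (simp add: state_val_def base_one)
  have "state_val (x m) = cls (u @ replicate m (Stable, True))"
    unfolding x_fold
    by (subst state_val_fold)
      (use u replicate_stable_words in \<open>auto simp: origin_states origin_val cls_closed\<close>)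
  also have "\<dots> = cls u \<otimes>\<^bsub>G\<^esub> stable True [^]\<^bsub>G\<^esub> m"
    using cls_append[OF u replicate_stable_words] by (simp add: cls_replicate_stable)
  finally have "cls u \<otimes>\<^bsub>G\<^esub> stable True [^]\<^bsub>G\<^esub> m = state_val (x m)" ..
  also have "\<dots> = stable True [^]\<^bsub>G\<^esub> k"
    unfolding xm state_val_fold[OF replicate_stable_words origin_states]
    by (simp add: origin_val cls_replicate_stable stable_closed)
  finally show ?thesis by blast
qed

lemma conjugating_positive_power:
  assumes g: "g \<in> carrier G" and n: "0 < n" and q: "0 < q"
    and conj: "g \<otimes>\<^bsub>G\<^esub> stable True [^]\<^bsub>G\<^esub> (n::nat) = stable e [^]\<^bsub>G\<^esub> (q::nat) \<otimes>\<^bsub>G\<^esub> g"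
    and dom: "\<And>l. l \<in> carrier L \<Longrightarrow> l \<noteq> \<one> \<Longrightarrow> \<exists>j>0. l \<notin> Dom H K \<phi> j"
  shows "g \<in> generate G {stable True}"
proof -
  obtain u where u: "u \<in> hnn_words" "g = cls u" using carrier_obtain_word[OF g] .
  have "g \<otimes>\<^bsub>G\<^esub> stable True [^]\<^bsub>G\<^esub> (n * N) = stable e [^]\<^bsub>G\<^esub> (q * N) \<otimes>\<^bsub>G\<^esub> g" for N
    using G.intertwines_power[OF _ _ g conj] by (simp add: G.nat_pow_pow stable_closed)
  then have "cls (u @ replicate (n * N) (Stable, True)) = cls (replicate (q * N) (Stable, e) @ u)" for N
    using u by (simp add: cls_append replicate_stable_words cls_replicate_stable)
  then obtain m k :: nat where mk: "g \<otimes>\<^bsub>G\<^esub> stable True [^]\<^bsub>G\<^esub> m = stable True [^]\<^bsub>G\<^esub> k"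
    using absorbed_by_stable[OF u(1) n q _ dom] u(2) by blast
  then have "g = stable True [^]\<^bsub>G\<^esub> k \<otimes>\<^bsub>G\<^esub> inv\<^bsub>G\<^esub> (stable True [^]\<^bsub>G\<^esub> m)"
    using g by (simp add: G.inv_solve_right stable_closed)
  also have "\<dots> = stable True [^]\<^bsub>G\<^esub> (int k - int m)"
    by (simp add: G.int_pow_diff int_pow_int stable_closed)
  finally show ?thesis using G.generate_pow[OF stable_closed] by blast
qed

lemma stable_int_pow:
  "\<exists>e. stable True [^]\<^bsub>G\<^esub> (q::int) = stable e [^]\<^bsub>G\<^esub> nat \<bar>q\<bar>"
proof (cases q rule: int_cases2)
  case (nonneg k)
  then have "stable True [^]\<^bsub>G\<^esub> q = stable True [^]\<^bsub>G\<^esub> nat \<bar>q\<bar>"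
    by (simp add: int_pow_int)
  then show ?thesis ..
next
  case (nonpos k)
  then have "stable True [^]\<^bsub>G\<^esub> q = inv\<^bsub>G\<^esub> (stable True [^]\<^bsub>G\<^esub> k)"
    by (simp only: G.int_pow_neg[OF stable_closed] int_pow_int)
  also have "\<dots> = stable False [^]\<^bsub>G\<^esub> k"
    by (simp only: G.nat_pow_inv[OF stable_closed] stable_False_eq_inv)
  also have "k = nat \<bar>q\<bar>" using nonpos by simp
  finally show ?thesis ..
qed

text \<open>Inverting both powers reduces a negative exponent \<open>n\<close> to a positive one; the sign of \<open>q\<close>
  becomes the sign of the letter in \<open>absorbed_by_stable\<close>.\<close>

lemma conjugating_power:
  assumes g: "g \<in> carrier G" and n: "n \<noteq> 0" and q: "q \<noteq> 0"
    and conj: "g \<otimes>\<^bsub>G\<^esub> stable True [^]\<^bsub>G\<^esub> (n::int) = stable True [^]\<^bsub>G\<^esub> (q::int) \<otimes>\<^bsub>G\<^esub> g"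
    and dom: "\<And>l. l \<in> carrier L \<Longrightarrow> l \<noteq> \<one> \<Longrightarrow> \<exists>j>0. l \<notin> Dom H K \<phi> j"
  shows "g \<in> generate G {stable True}"
proof -
  have positive: ?thesis
    if n': "n' > 0" and q': "q' \<noteq> 0"
      and conj': "g \<otimes>\<^bsub>G\<^esub> stable True [^]\<^bsub>G\<^esub> n' = stable True [^]\<^bsub>G\<^esub> q' \<otimes>\<^bsub>G\<^esub> g"
    for n' q' :: int
  proof -
    obtain e where e: "stable True [^]\<^bsub>G\<^esub> q' = stable e [^]\<^bsub>G\<^esub> nat \<bar>q'\<bar>"
      using stable_int_pow by blast
    have "stable True [^]\<^bsub>G\<^esub> n' = stable True [^]\<^bsub>G\<^esub> nat n'"
      using n' int_pow_int[of G "stable True" "nat n'"] by simp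
    then show ?thesis
      using conjugating_positive_power[of g "nat n'" "nat \<bar>q'\<bar>" e] g n' q' conj' e dom by simp
  qed
  show ?thesis
  proof (cases "n > 0")
    case True
    then show ?thesis using positive q conj by blast
  next
    case False
    have "g \<otimes>\<^bsub>G\<^esub> stable True [^]\<^bsub>G\<^esub> (- n) = stable True [^]\<^bsub>G\<^esub> (- q) \<otimes>\<^bsub>G\<^esub> g"
      using G.intertwines_inv[OF _ _ g conj] by (simp add: G.int_pow_neg stable_closed)
    then show ?thesis using positive[of "- n" "- q"] n q False by simp
  qed
qed

lemma malnormal_stable:
  assumes dom: "\<And>l. l \<in> carrier L \<Longrightarrow> l \<noteq> \<one> \<Longrightarrow> \<exists>j>0. l \<notin> Dom H K \<phi> j"
  shows "malnormal (generate G {stable True}) G"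
proof -
  let ?t = "stable True" and ?S = "generate G {stable True}"
  have sub: "subgroup ?S G"
    by (rule G.generate_is_subgroup) (use stable_closed in blast)
  have trivial: "y = \<one>\<^bsub>G\<^esub>"
    if g: "g \<in> carrier G - ?S" and y: "y \<in> (g <#\<^bsub>G\<^esub> ?S) #>\<^bsub>G\<^esub> inv\<^bsub>G\<^esub> g" "y \<in> ?S" for g y
  proof -
    have gc: "g \<in> carrier G" using g by simp
    obtain n q :: int where n: "y = g \<otimes>\<^bsub>G\<^esub> ?t [^]\<^bsub>G\<^esub> n \<otimes>\<^bsub>G\<^esub> inv\<^bsub>G\<^esub> g"
      and q: "y = ?t [^]\<^bsub>G\<^esub> q"
      using y unfolding G.generate_pow[OF stable_closed] l_coset_def r_coset_def by blast
    \<comment> \<open>If \<open>n\<close> or \<open>q\<close> vanishes then \<open>y\<close> is trivial; otherwise \<open>g\<close> would be a power of \<open>t\<close>.\<close>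
    have conj: "g \<otimes>\<^bsub>G\<^esub> ?t [^]\<^bsub>G\<^esub> n = ?t [^]\<^bsub>G\<^esub> q \<otimes>\<^bsub>G\<^esub> g"
      unfolding q[symmetric] n using gc by (simp add: G.m_assoc stable_closed)
    then have "n = 0 \<or> q = 0"
      using conjugating_power[OF gc _ _ conj dom] g by blast
    then show ?thesis
    proof
      assume "n = 0"
      then show ?thesis unfolding n using gc by simp
    next
      assume "q = 0"
      then show ?thesis unfolding q by simp
    qed
  qed
  have "\<one>\<^bsub>G\<^esub> \<in> (g <#\<^bsub>G\<^esub> ?S) #>\<^bsub>G\<^esub> inv\<^bsub>G\<^esub> g" if "g \<in> carrier G" for g
  proof -
    have "\<one>\<^bsub>G\<^esub> = g \<otimes>\<^bsub>G\<^esub> \<one>\<^bsub>G\<^esub> \<otimes>\<^bsub>G\<^esub> inv\<^bsub>G\<^esub> g" using that by simp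
    then show ?thesis
      using generate.one[of G "{?t}"] unfolding l_coset_def r_coset_def by blast
  qed
  then have "((g <#\<^bsub>G\<^esub> ?S) #>\<^bsub>G\<^esub> inv\<^bsub>G\<^esub> g) \<inter> ?S = {\<one>\<^bsub>G\<^esub>}" if "g \<in> carrier G - ?S" for g
    using trivial[OF that] that generate.one[of G "{?t}"] by (intro equalityI subsetI) auto
  then show ?thesis
    unfolding malnormal_def using sub by blast
qed

end

theorem corollary4p4:
  fixes \<Lambda> :: "('a, 'b) monoid_scheme" and H K :: "'a set" and \<phi> :: "'a \<Rightarrow> 'a"
  assumes "group \<Lambda>"
    and "subgroup H \<Lambda>"
    and "subgroup K \<Lambda>"
    and "\<phi> \<in> iso (\<Lambda>\<lparr>carrier := H\<rparr>) (\<Lambda>\<lparr>carrier := K\<rparr>)"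
    and "\<forall>l \<in> carrier \<Lambda> - {\<one>\<^bsub>\<Lambda>\<^esub>}. \<exists>j>0. l \<notin> Dom H K \<phi> j"
  shows "malnormal (generate (HNN \<Lambda> H K \<phi>) {stable_letter \<Lambda> H K \<phi>}) (HNN \<Lambda> H K \<phi>)"
proof -
  interpret hnn_data \<Lambda> H K \<phi>
    using assms(1-4) by (intro hnn_data.intro hnn_data_axioms.intro)
  show ?thesis
    unfolding stable_letter_def by (rule malnormal_stable) (use assms(5) in blast)
qed

end
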